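(* Let $\Psi$ be a set of atomic propositions. The logic $\mathrm{RSOL}$ is sound with respect to $\mathrm{SOL}$: for all terms $a,b\in\mathcal L_\Psi$, $$ \vdash_{\mathrm{RSOL}} a\leq b \ \Rightarrow\ \vdash_{\mathrm{SOL}} a\leq b .$$
   Context: A bounded orthoposet $\langle P,\leq,{}^\bot\rangle$ is a partially ordered set with least element $0$ and greatest element $1$ and an orthocomplementation $a\mapsto a^\bot$, i.e. an order-reversing involution ($a\le b\Rightarrow b^\bot\le a^\bot$, $a^{\bot\bot}=a$) such that for every $a$ the meet of $a$ and $a^\bot$ exists and is $0$, and their join exists and is $1$. A Sasaki orthoposet is a tuple $\langle P,\leq,{}^\bot,\&\rangle$ where $\langle P,\leq,{}^\bot\rangle$ is a bounded orthoposet and $\&:P^2\to P$ is a total binary operation such that for all $a,b,c\in P$: (L-Monotony) $a\le b \Rightarrow a\,\&\,c\le b\,\&\,c$; (R-Reduction) $a\,\&\,b\le b$; (Orthomodularity) $a\le b\Rightarrow a=a\,\&\,b$; (Galois) $a\,\&\,b\le c\Rightarrow c^\bot\,\&\,b\le a^\bot$. Terms: $\mathcal L_\Psi$ is the set of terms generated by the grammar $t ::= p \mid t\,\&\,t \mid t^\bot$ with $p\in\Psi$ (purely syntactic; $t^{\bot\bot}$ is a different term from $t$). Semantics ($\mathrm{SOL}$): a $\Psi$-Sasaki model $\mathcal M$ is a Sasaki orthoposet $\langle P,\leq_P,{}^{\bot_P},\&_P\rangle$ together with a function $\nu:\Psi\to P$. The interpretation $[\![\cdot]\!]_{\mathcal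 M}:\mathcal L_\Psi\to P$ is defined inductively by $[\![p]\!]_{\mathcal M}=\nu(p)$ for $p\in\Psi$, $[\![t^\bot]\!]_{\mathcal M}=([\![t]\!]_{\mathcal M})^{\bot_P}$, $[\![t_1\,\&\,t_2]\!]_{\mathcal M}=[\![t_1]\!]_{\mathcal M}\,\&_P\,[\![t_2]\!]_{\mathcal M}$. One writes $\vdash_{\mathrm{SOL}} t_1\leq t_2$ iff $[\![t_1]\!]_{\mathcal M}\leq_P[\![t_2]\!]_{\mathcal M}$ for every $\Psi$-Sasaki model $\mathcal M$. Rules ($\mathrm{RSOL}$): $\vdash_{\mathrm{RSOL}} a\leq b$ means the formal inequality $a\le b$ is derivable by finite proof trees from the following rules, for arbitrary terms $a,b,c,d\in\mathcal L_\Psi$: ($A$) infer $a\leq a$ (no premise); ($S$) from $b^\bot\leq a^\bot$ infer $a\leq b$; ($G$) from $c^\bot\,\&\,b\leq a^\bot$ infer $a\,\&\,b\leq c$; ($N_L$) from $a\leq b$ infer $a^{\bot\bot}\leq b$; ($N_R$) from $a\leq b$ infer $a\leq b^{\bot\bot}$; ($T$) from $a\leq b$ and $b\leq c$ infer $a\leq c$; ($O_L$) from $a\leq b$ and $a\leq c$ infer $a\,\&\,b\leq c$; ($O_R$) from $a\leq b$ and $a\leq c$ infer $a\leq b\,\&\,c$; ($R$) from $b\leq c$ infer $a\,\&\,b\leq c$; ($M$) from $a\leq c$, $b\leq d$ and $d\leq b$ infer $a\,\&\,b\leq c\,\&\,d$. *)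

theory Defs
  imports "HOL-Algebra.Order" "HOL-Library.FuncSet"
begin

section \<open>Sasaki orthoposets\<close>

record 'a ortho_order = "'a gorder" +
  ortho :: "'a \<Rightarrow> 'a" (\<open>_\<^sup>\<bottom>\<index>\<close> [90] 90)

record 'a sasaki_order = "'a ortho_order" +
  sasaki :: "'a \<Rightarrow> 'a \<Rightarrow> 'a" (infixl \<open>\<odot>\<index>\<close> 70)

locale bounded_orthoposet =
  partial_order P + weak_partial_order_bottom P + weak_partial_order_top P
  for P (structure) +
  assumes ortho_closed: "a \<in> carrier P \<Longrightarrow> a\<^sup>\<bottom> \<in> carrier P"
    and ortho_antimono: "\<lbrakk>a \<in> carrier P; b \<in> carrier P; a \<sqsubseteq> b\<rbrakk> \<Longrightarrow> b\<^sup>\<bottom> \<sqsubseteq> a\<^sup>\<bottom>"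
    and ortho_involution: "a \<in> carrier P \<Longrightarrow> a\<^sup>\<bottom>\<^sup>\<bottom> = a"
    and ortho_meet: "a \<in> carrier P \<Longrightarrow> is_glb P \<bottom> {a, a\<^sup>\<bottom>}"
    and ortho_join: "a \<in> carrier P \<Longrightarrow> is_lub P \<top> {a, a\<^sup>\<bottom>}"

locale sasaki_orthoposet = bounded_orthoposet P for P (structure) +
  assumes sasaki_closed: "\<lbrakk>a \<in> carrier P; b \<in> carrier P\<rbrakk> \<Longrightarrow> a \<odot> b \<in> carrier P"
    and L_monotony:
      "\<lbrakk>a \<in> carrier P; b \<in> carrier P; c \<in> carrier P; a \<sqsubseteq> b\<rbrakk> \<Longrightarrow> a \<odot> c \<sqsubseteq> b \<odot> c"
    and R_reduction: "\<lbrakk>a \<in> carrier P; b \<in> carrier P\<rbrakk> \<Longrightarrow> a \<odot> b \<sqsubseteq> b"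
    and orthomodularity: "\<lbrakk>a \<in> carrier P; b \<in> carrier P; a \<sqsubseteq> b\<rbrakk> \<Longrightarrow> a = a \<odot> b"
    and galois:
      "\<lbrakk>a \<in> carrier P; b \<in> carrier P; c \<in> carrier P; a \<odot> b \<sqsubseteq> c\<rbrakk> \<Longrightarrow> c\<^sup>\<bottom> \<odot> b \<sqsubseteq> a\<^sup>\<bottom>"

section \<open>Terms\<close>

datatype 'p sterm = Atom 'p | And "'p sterm" "'p sterm" | Perp "'p sterm"

inductive_set lang :: "'p set \<Rightarrow> 'p sterm set" for \<Psi> :: "'p set" where
  Atom: "p \<in> \<Psi> \<Longrightarrow> Atom p \<in> lang \<Psi>"
| And: "\<lbrakk>s \<in> lang \<Psi>; t \<in> lang \<Psi>\<rbrakk> \<Longrightarrow> And s t \<in> lang \<Psi>"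
| Perp: "t \<in> lang \<Psi> \<Longrightarrow> Perp t \<in> lang \<Psi>"

section \<open>Semantics\<close>

locale sasaki_model = sasaki_orthoposet P
  for \<Psi> :: "'p set" and P :: "'m sasaki_order" (structure) and \<nu> :: "'p \<Rightarrow> 'm" +
  assumes valuation: "\<nu> \<in> \<Psi> \<rightarrow> carrier P"

primrec interp :: "'m sasaki_order \<Rightarrow> ('p \<Rightarrow> 'm) \<Rightarrow> 'p sterm \<Rightarrow> 'm" where
  "interp P \<nu> (Atom p) = \<nu> p"
| "interp P \<nu> (And s t) = interp P \<nu> s \<odot>\<^bsub>P\<^esub> interp P \<nu> t"
| "interp P \<nu> (Perp t) = (interp P \<nu> t)\<^sup>\<bottom>\<^bsub>P\<^esub>"

text \<open>HOL cannot quantify over types inside a formula, so the type from which the carriers of the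
  models are drawn is a parameter. A theorem in which it is a free type variable speaks about
  models over every type.\<close>

definition SOL :: "'m itself \<Rightarrow> 'p set \<Rightarrow> 'p sterm \<Rightarrow> 'p sterm \<Rightarrow> bool" where
  "SOL _ \<Psi> a b \<longleftrightarrow>
    (\<forall>(P :: 'm sasaki_order) \<nu>. sasaki_model \<Psi> P \<nu> \<longrightarrow> interp P \<nu> a \<sqsubseteq>\<^bsub>P\<^esub> interp P \<nu> b)"

section \<open>Derivability\<close>

inductive RSOL :: "'p set \<Rightarrow> 'p sterm \<Rightarrow> 'p sterm \<Rightarrow> bool" for \<Psi> :: "'p set" where
  A: "a \<in> lang \<Psi> \<Longrightarrow> RSOL \<Psi> a a"
| S: "\<lbrakk>a \<in> lang \<Psi>; b \<in> lang \<Psi>; RSOL \<Psi> (Perp b) (Perp a)\<rbrakk> \<Longrightarrow> RSOL \<Psi> a b"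
| G: "\<lbrakk>a \<in> lang \<Psi>; b \<in> lang \<Psi>; c \<in> lang \<Psi>; RSOL \<Psi> (And (Perp c) b) (Perp a)\<rbrakk>
      \<Longrightarrow> RSOL \<Psi> (And a b) c"
| N_L: "\<lbrakk>a \<in> lang \<Psi>; b \<in> lang \<Psi>; RSOL \<Psi> a b\<rbrakk> \<Longrightarrow> RSOL \<Psi> (Perp (Perp a)) b"
| N_R: "\<lbrakk>a \<in> lang \<Psi>; b \<in> lang \<Psi>; RSOL \<Psi> a b\<rbrakk> \<Longrightarrow> RSOL \<Psi> a (Perp (Perp b))"
| T: "\<lbrakk>a \<in> lang \<Psi>; b \<in> lang \<Psi>; c \<in> lang \<Psi>; RSOL \<Psi> a b; RSOL \<Psi> b c\<rbrakk> \<Longrightarrow> RSOL \<Psi> a c"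
| O_L: "\<lbrakk>a \<in> lang \<Psi>; b \<in> lang \<Psi>; c \<in> lang \<Psi>; RSOL \<Psi> a b; RSOL \<Psi> a c\<rbrakk>
      \<Longrightarrow> RSOL \<Psi> (And a b) c"
| O_R: "\<lbrakk>a \<in> lang \<Psi>; b \<in> lang \<Psi>; c \<in> lang \<Psi>; RSOL \<Psi> a b; RSOL \<Psi> a c\<rbrakk>
      \<Longrightarrow> RSOL \<Psi> a (And b c)"
| R: "\<lbrakk>a \<in> lang \<Psi>; b \<in> lang \<Psi>; c \<in> lang \<Psi>; RSOL \<Psi> b c\<rbrakk> \<Longrightarrow> RSOL \<Psi> (And a b) c"
| M: "\<lbrakk>a \<in> lang \<Psi>; b \<in> lang \<Psi>; c \<in> lang \<Psi>; d \<in> lang \<Psi>;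
       RSOL \<Psi> a c; RSOL \<Psi> b d; RSOL \<Psi> d b\<rbrakk> \<Longrightarrow> RSOL \<Psi> (And a b) (And c d)"

end

theory Submission
  imports Defs
begin

text \<open>Induction on derivations: in a fixed model, each rule preserves truth of inequalities.
  \<open>S\<close> and \<open>G\<close> reverse order-reversal and Galois by involution;
  \<open>N_L\<close> and \<open>N_R\<close> are involution itself; \<open>R\<close> rests on
  R-reduction, \<open>O_L\<close> and \<open>O_R\<close> on orthomodularity, \<open>M\<close> on
  left monotony.\<close>

context sasaki_orthoposet
begin

lemma ortho_le_ortho_cancel:
  assumes "a \<in> carrier P" "b \<in> carrier P" "b\<^sup>\<bottom> \<sqsubseteq> a\<^sup>\<bottom>"
  shows "a \<sqsubseteq> b"
  using ortho_antimono[of "b\<^sup>\<bottom>" "a\<^sup>\<bottom>"] assms by (simp add: ortho_closed ortho_involution)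

text \<open>Galois applied to the complements of \<open>c\<close> and \<open>a\<close>; double
  complements cancel.\<close>

lemma galois_converse:
  assumes "a \<in> carrier P" "b \<in> carrier P" "c \<in> carrier P" "c\<^sup>\<bottom> \<odot> b \<sqsubseteq> a\<^sup>\<bottom>"
  shows "a \<odot> b \<sqsubseteq> c"
  using galois[of "c\<^sup>\<bottom>" b "a\<^sup>\<bottom>"] assms by (simp add: ortho_closed ortho_involution)

text \<open>Orthomodularity and left monotony give
  \<open>a = a \<odot> c \<sqsubseteq> b \<odot> c\<close>.\<close>

lemma sasaki_greatest:
  assumes "a \<in> carrier P" "b \<in> carrier P" "c \<in> carrier P" "a \<sqsubseteq> b" "a \<sqsubseteq> c"
  shows "a \<sqsubseteq> b \<odot> c"
  using L_monotony[of a b c] orthomodularity[of a c] assms by simp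

lemma sasaki_le_if_right_le:
  assumes "a \<in> carrier P" "b \<in> carrier P" "c \<in> carrier P" "b \<sqsubseteq> c"
  shows "a \<odot> b \<sqsubseteq> c"
  using assms by (blast intro: le_trans R_reduction sasaki_closed)

end

context sasaki_model
begin

text \<open>The axioms hold only on the carrier; the rules supply the membership in
  \<open>lang \<Psi>\<close> that this needs.\<close>

lemma interp_closed: "t \<in> lang \<Psi> \<Longrightarrow> interp P \<nu> t \<in> carrier P"
  by (induction rule: lang.induct)
    (use valuation in \<open>auto simp: ortho_closed sasaki_closed\<close>)

lemma RSOL_sound: "RSOL \<Psi> a b \<Longrightarrow> interp P \<nu> a \<sqsubseteq> interp P \<nu> b"
proof (induction rule: RSOL.induct)
  case (A a)
  then show ?case by (simp add: interp_closed)
next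
  case (S a b)
  then show ?case by (simp add: interp_closed ortho_le_ortho_cancel)
next
  case (G a b c)
  then show ?case by (simp add: interp_closed galois_converse)
next
  case (N_L a b)
  then show ?case by (simp add: interp_closed ortho_involution)
next
  case (N_R a b)
  then show ?case by (simp add: interp_closed ortho_involution)
next
  case (T a b c)
  then show ?case by (blast intro: le_trans interp_closed)
next
  case (O_L a b c)
  \<comment> \<open>The first premise makes \<open>a \<odot> b\<close> equal to \<open>a\<close>,
    and the second bounds \<open>a\<close>.\<close>
  then show ?case
    using orthomodularity[of "interp P \<nu> a" "interp P \<nu> b"] by (simp add: interp_closed)
next
  case (O_R a b c)
  then show ?case by (simp add: interp_closed sasaki_greatest)
next
  case (R a b c)
  then show ?case by (simp add: interp_closed sasaki_le_if_right_le)
next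
  case (M a b c d)
  \<comment> \<open>Monotony is given only on the left; antisymmetry makes the right arguments
    equal.\<close>
  then have "interp P \<nu> b = interp P \<nu> d"
    by (blast intro: le_antisym interp_closed)
  with M show ?case by (simp add: interp_closed L_monotony)
qed

end

theorem proposition7:
  fixes \<Psi> :: "'p set" and a b :: "'p sterm"
  assumes "a \<in> lang \<Psi>" and "b \<in> lang \<Psi>"
    and "RSOL \<Psi> a b"
  shows "SOL TYPE('m) \<Psi> a b"
  unfolding SOL_def using assms(3) by (blast intro: sasaki_model.RSOL_sound)

end
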